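(* Let $M$ be a non-metrizable Type I manifold which contains a closed non-Lindelöf subspace that is functionally narrow in $M$. Then $M$ is not homotopy equivalent to a CW-complex.
   Context: A manifold is a connected Hausdorff space each of whose points has a neighborhood homeomorphic to $\mathbb{R}^n$ for some finite $n\ge 1$ (no second countability or metrizability is assumed). A space $X$ is of Type I if $X=\bigcup_{\alpha\in\omega_1}X_\alpha$, where each $X_\alpha$ is open, each $\overline{X_\alpha}$ is Lindelöf, and $\overline{X_\alpha}\subset X_\beta$ whenever $\alpha<\beta<\omega_1$; the cover may be (and is) chosen canonical, i.e. $X_\alpha=\bigcup_{\beta<\alpha}X_\beta$ for each limit $\alpha$. A subset of $X$ is bounded if it is contained in some $X_\alpha$, and unbounded otherwise. The closed longray $\mathbb{L}_{\ge 0}$ is $\omega_1\times[0,1)$ with the lexicographic order topology; $\alpha\in\omega_1$ is identified with $\langle\alpha,0\rangle\in\mathbb{L}_{\ge 0}$, and $[\alpha,\omega_1)$ denotes the set of points of $\mathbb{L}_{\ge 0}$ that are $\ge\alpha$. A subset of $\mathbb{L}_{\ge 0}$ is unbounded if it has no upper bound in $\mathbb{L}_{\ge 0}$. "Club" means closed and unbounded. A closed subspace $D$ of a Type I space $X$ is functionally narrow in $X$ if it satisfies the following two conditions (which are known to be equivalent when $D$ is closed and unbounded): (a) for each continuous $f:X\to\mathbb{L}_{\ge 0}$ with $f(D)$ unbounded, the set of $\alpha\in\omega_1$ such that $f(D-X_\alpha)\subset[\alpha,\omega_1)$ is club in $\omega_1$; (b) for each continuous $f:X\to\mathbb{L}_{\ge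 0}$ with $f(D)$ unbounded, $f^{-1}(\{0\})\cap D$ is bounded in $X$. *)

theory Defs
  imports "HOL-Analysis.Analysis" "HOL-Library.Countable_Set_Type"
begin

section \<open>The first uncountable ordinal\<close>

typedef omega1 = "Field (cardSuc natLeq)"
proof -
  have "infinite (Field (cardSuc natLeq))"
    using cardSuc_finite[OF natLeq_Card_order] by (simp add: Field_natLeq)
  then show ?thesis
    by (metis ex_in_conv finite.emptyI)
qed

lemma wo_rel_cardSuc_natLeq: "wo_rel (cardSuc natLeq)"
  using cardSuc_Card_order[OF natLeq_Card_order]
  by (simp add: card_order_on_def wo_rel_def)

instantiation omega1 :: wellorder
begin

definition less_eq_omega1 :: "omega1 \<Rightarrow> omega1 \<Rightarrow> bool"
  where "(x::omega1) \<le> y \<longleftrightarrow> (Rep_omega1 x, Rep_omega1 y) \<in> cardSuc natLeq"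

definition less_omega1 :: "omega1 \<Rightarrow> omega1 \<Rightarrow> bool"
  where "(x::omega1) < y \<longleftrightarrow> x \<le> y \<and> x \<noteq> y"

instance
proof
  interpret wo_rel "cardSuc natLeq" by (rule wo_rel_cardSuc_natLeq)
  fix x y z :: omega1
  show le_refl: "x \<le> x"
    using REFL Rep_omega1[of x] by (auto simp: less_eq_omega1_def refl_on_def)
  show le_antisym: "x = y" if "x \<le> y" "y \<le> x" for x y :: omega1
    using that ANTISYM unfolding less_eq_omega1_def antisym_def Rep_omega1_inject[symmetric] by blast
  show "(x < y) = (x \<le> y \<and> \<not> y \<le> x)"
    using le_antisym le_refl by (auto simp: less_omega1_def)
  show "x \<le> z" if "x \<le> y" "y \<le> z"
    using that TRANS by (auto simp: less_eq_omega1_def trans_def)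
  show "x \<le> y \<or> y \<le> x"
    using TOTALS Rep_omega1 by (auto simp: less_eq_omega1_def)
next
  fix P :: "omega1 \<Rightarrow> bool" and a :: omega1
  assume step: "\<And>x. (\<And>y. y < x \<Longrightarrow> P y) \<Longrightarrow> P x"
  interpret wo_rel "cardSuc natLeq" by (rule wo_rel_cardSuc_natLeq)
  have "wf {(x::omega1, y). x < y}"
  proof (rule wf_subset[OF wf_inv_image[OF WF, of Rep_omega1]])
    show "{(x::omega1, y). x < y} \<subseteq> inv_image (cardSuc natLeq - Id) Rep_omega1"
      by (auto simp: less_omega1_def less_eq_omega1_def inv_image_def Rep_omega1_inject)
  qed
  then show "P a"
    by (induction a rule: wf_induct_rule) (use step in auto)
qed

end

text \<open>Together with the well-ordering, the next two facts characterise \<^typ>\<open>omega1\<close>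
  as having order type \<open>\<omega>\<^sub>1\<close>.\<close>

lemma countable_lessThan_omega1:
  includes cardinal_syntax
  shows "countable {..<a :: omega1}"
proof -
  let ?r = "cardSuc natLeq"
  have "|underS ?r (Rep_omega1 a)| <o ?r"
    by (rule card_of_underS[OF cardSuc_Card_order[OF natLeq_Card_order] Rep_omega1])
  then have "countable (underS ?r (Rep_omega1 a))"
    by (simp add: countable_card_le_natLeq
        cardSuc_ordLeq_ordLess[OF natLeq_Card_order card_of_Card_order])
  moreover have "Rep_omega1 ` {..<a} \<subseteq> underS ?r (Rep_omega1 a)"
    by (auto simp: underS_def less_omega1_def less_eq_omega1_def Rep_omega1_inject)
  ultimately have "countable (Rep_omega1 ` {..<a})"
    by (rule countable_subset[rotated])
  then show ?thesis
    by (rule countable_image_inj_on) (simp add: inj_on_def Rep_omega1_inject)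
qed

lemma uncountable_UNIV_omega1:
  includes cardinal_syntax
  shows "uncountable (UNIV :: omega1 set)"
proof
  let ?r = "cardSuc natLeq"
  assume "countable (UNIV :: omega1 set)"
  then have "countable (range Rep_omega1)" by simp
  then have "countable (Field ?r)"
    using type_definition.Rep_range[OF type_definition_omega1] by simp
  then have "|Field ?r| \<le>o natLeq"
    by (simp add: countable_card_le_natLeq)
  then have "?r \<le>o natLeq"
    using card_of_Field_ordIso[OF cardSuc_Card_order[OF natLeq_Card_order]]
      ordIso_ordLeq_trans ordIso_symmetric by blast
  then show False
    using cardSuc_greater[OF natLeq_Card_order] not_ordLess_ordLeq by blast
qed

instantiation omega1 :: "{linorder_topology, zero}"
begin

definition open_omega1 :: "omega1 set \<Rightarrow> bool"
  where "open_omega1 = generate_topology (range lessThan \<union> range greaterThan)"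

definition zero_omega1 :: omega1
  where "(0::omega1) = (LEAST a. True)"

instance
  by standard (simp add: open_omega1_def)

end

definition limit_omega1 :: "omega1 \<Rightarrow> bool"
  where "limit_omega1 a \<longleftrightarrow> a \<noteq> 0 \<and> (\<forall>b<a. \<exists>c<a. b < c)"

text \<open>No upper bound in \<open>\<omega>\<^sub>1\<close> is the same as cofinal, since \<open>\<omega>\<^sub>1\<close> has no greatest element.\<close>

definition club :: "omega1 set \<Rightarrow> bool"
  where "club C \<longleftrightarrow> closed C \<and> \<not> bdd_above C"

section \<open>The closed long ray\<close>

typedef longray = "(UNIV :: omega1 set) \<times> {0..<1::real}"
  by (intro exI[of _ "(0, 0)"]) simp

instantiation longray :: linorder
begin

definition less_eq_longray :: "longray \<Rightarrow> longray \<Rightarrow> bool"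
  where "(x::longray) \<le> y \<longleftrightarrow> fst (Rep_longray x) < fst (Rep_longray y) \<or>
    fst (Rep_longray x) = fst (Rep_longray y) \<and> snd (Rep_longray x) \<le> snd (Rep_longray y)"

definition less_longray :: "longray \<Rightarrow> longray \<Rightarrow> bool"
  where "(x::longray) < y \<longleftrightarrow> fst (Rep_longray x) < fst (Rep_longray y) \<or>
    fst (Rep_longray x) = fst (Rep_longray y) \<and> snd (Rep_longray x) < snd (Rep_longray y)"

instance
  by standard
    (auto simp: less_eq_longray_def less_longray_def Rep_longray_inject[symmetric] prod_eq_iff)

end

definition longray_of :: "omega1 \<Rightarrow> longray"
  where "longray_of a = Abs_longray (a, 0)"

instantiation longray :: "{linorder_topology, zero}"
begin

definition open_longray :: "longray set \<Rightarrow> bool"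
  where "open_longray = generate_topology (range lessThan \<union> range greaterThan)"

definition zero_longray :: longray
  where "0 = longray_of 0"

instance
  by standard (simp add: open_longray_def)

end

section \<open>Manifolds, Type I spaces, functional narrowness\<close>

text \<open>Neither second countability nor metrizability is required. The dimension is chosen
  pointwise, and neighbourhoods need not be open.\<close>

definition manifold :: "'a topology \<Rightarrow> bool"
  where "manifold X \<longleftrightarrow> connected_space X \<and> Hausdorff_space X \<and>
    (\<forall>x\<in>topspace X. \<exists>n\<ge>1. \<exists>U V. openin X U \<and> x \<in> U \<and> U \<subseteq> V \<and> V \<subseteq> topspace X \<and>
       subtopology X V homeomorphic_space Euclidean_space n)"

definition type_I_cover :: "'a topology \<Rightarrow> (omega1 \<Rightarrow> 'a set) \<Rightarrow> bool"
  where "type_I_cover X U \<longleftrightarrow>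
    topspace X = (\<Union>a. U a) \<and>
    (\<forall>a. openin X (U a)) \<and>
    (\<forall>a. Lindelof_space (subtopology X (X closure_of U a))) \<and>
    (\<forall>a b. a < b \<longrightarrow> X closure_of U a \<subseteq> U b)"

definition canonical_cover :: "(omega1 \<Rightarrow> 'a set) \<Rightarrow> bool"
  where "canonical_cover U \<longleftrightarrow> (\<forall>a. limit_omega1 a \<longrightarrow> U a = (\<Union>b\<in>{..<a}. U b))"

definition bounded_in_cover :: "(omega1 \<Rightarrow> 'a set) \<Rightarrow> 'a set \<Rightarrow> bool"
  where "bounded_in_cover U B \<longleftrightarrow> (\<exists>a. B \<subseteq> U a)"

definition functionally_narrow :: "'a topology \<Rightarrow> (omega1 \<Rightarrow> 'a set) \<Rightarrow> 'a set \<Rightarrow> bool"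
  where "functionally_narrow X U D \<longleftrightarrow> closedin X D \<and>
    (\<forall>f :: 'a \<Rightarrow> longray. continuous_map X euclidean f \<and> \<not> bdd_above (f ` D) \<longrightarrow>
       club {a. f ` (D - U a) \<subseteq> {longray_of a..}}) \<and>
    (\<forall>f :: 'a \<Rightarrow> longray. continuous_map X euclidean f \<and> \<not> bdd_above (f ` D) \<longrightarrow>
       bounded_in_cover U (f -` {0} \<inter> D))"

section \<open>CW-complexes\<close>

definition cell_disk :: "nat \<Rightarrow> (nat \<Rightarrow> real) topology"
  where "cell_disk n = subtopology (Euclidean_space n) {x. (\<Sum>i<n. (x i)\<^sup>2) \<le> 1}"

definition cell_interior :: "nat \<Rightarrow> (nat \<Rightarrow> real) set"
  where "cell_interior n = {x \<in> topspace (cell_disk n). (\<Sum>i<n. (x i)\<^sup>2) < 1}"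

definition cell_boundary :: "nat \<Rightarrow> (nat \<Rightarrow> real) set"
  where "cell_boundary n = {x \<in> topspace (cell_disk n). (\<Sum>i<n. (x i)\<^sup>2) = 1}"

text \<open>Whitehead's definition: \<open>E\<close> is the set of open cells, \<open>d e\<close> the dimension of the cell
  \<open>e\<close> and \<open>\<Phi> e\<close> its characteristic map. The last two conjuncts are closure-finiteness
  and the weak topology.\<close>

definition CW_structure ::
    "'b topology \<Rightarrow> 'b set set \<Rightarrow> ('b set \<Rightarrow> nat) \<Rightarrow> ('b set \<Rightarrow> (nat \<Rightarrow> real) \<Rightarrow> 'b) \<Rightarrow> bool"
  where "CW_structure X E d \<Phi> \<longleftrightarrow>
    Hausdorff_space X \<and>
    \<Union>E = topspace X \<and> pairwise disjnt E \<and>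
    (\<forall>e\<in>E. continuous_map (cell_disk (d e)) X (\<Phi> e) \<and>
       homeomorphic_map (subtopology (cell_disk (d e)) (cell_interior (d e)))
         (subtopology X e) (\<Phi> e)) \<and>
    (\<forall>e\<in>E. \<exists>F\<subseteq>E. finite F \<and> (\<forall>e'\<in>F. d e' < d e) \<and> \<Phi> e ` cell_boundary (d e) \<subseteq> \<Union>F) \<and>
    (\<forall>A\<subseteq>topspace X. (\<forall>e\<in>E. closedin X (A \<inter> X closure_of e)) \<longrightarrow> closedin X A)"

definition CW_complex :: "'b topology \<Rightarrow> bool"
  where "CW_complex X \<longleftrightarrow> (\<exists>E d \<Phi>. CW_structure X E d \<Phi>)"

end

theory Submission
  imports Defs
begin

text \<open>
  The long ray tells \<open>M\<close> apart from CW-complexes. On the one hand, \<open>M\<close> carries a continuous map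
  \<open>s\<close> to the long ray that is unbounded on \<open>D\<close>: it is pieced together from Urysohn functions on
  the closures \<open>M closure_of U a\<close>, which are normal since they are regular and Lindelof
  (\<open>type_I_cover_unbounded_map\<close>). On the other hand, any two maps from a CW-complex to the long
  ray are homotopic (\<open>maps_to_longray_homotopic\<close>), because every compact subset of the long ray
  lies in an initial segment, which is a copy of a real interval and therefore an absolute
  extensor; so a homotopy can be built cell by cell with Tietze's theorem
  (\<open>Tietze_extension_longray\<close>).

  Functional narrowness makes the property of being unbounded on \<open>D\<close> invariant under homotopy
  (\<open>unbounded_on_narrow_homotopy_invariant\<close>). Both the times at which a homotopy is bounded
  on \<open>D\<close> and those at which it is unbounded on \<open>D\<close> form a closed set. For bounded times, countably
  many bounds in the long ray have a common bound. For unbounded times \<open>t n\<close>, narrowness attaches to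
  each \<open>t n\<close> a club of ordinals \<open>a\<close> such that the map at time \<open>t n\<close> is at least \<open>a\<close> on
  \<open>D - U a\<close>; countably many clubs have arbitrarily large common elements, and there the
  inequality passes to the limit. Connectedness of \<open>[0, 1]\<close> then excludes a change from unbounded
  to bounded.

  If \<open>f\<close> and \<open>g\<close> were mutually inverse homotopy equivalences between \<open>M\<close> and a CW-complex \<open>K\<close>,
  then \<open>s\<close> would be homotopic to \<open>s \<circ> g \<circ> f\<close>, and this in turn to a constant map, since
  \<open>s \<circ> g\<close> is defined on \<open>K\<close>. But \<open>s\<close> is unbounded on \<open>D\<close> and a constant map is not.

  The argument about closed sets of times uses the homotopy only at fixed times and at fixed
  points. Separate continuity is thus all that has to be shown for the homotopies on \<open>K\<close>, and no
  topology on \<open>K \<times> [0, 1]\<close> is involved.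
\<close>

section \<open>Countable sets in the first uncountable ordinal\<close>

text \<open>A countable union of countable initial segments cannot exhaust an uncountable well-order.\<close>

lemma countable_imp_strictly_bounded_omega1:
  fixes A :: "omega1 set"
  assumes "countable A"
  obtains b where "\<And>a. a \<in> A \<Longrightarrow> a < b"
proof -
  have "countable (\<Union>a\<in>A. {..a})"
    using assms countable_lessThan_omega1
    by (auto simp: lessThan_Suc_atMost[symmetric] ivl_disj_un_singleton(2)[symmetric])
  then have "(\<Union>a\<in>A. {..a}) \<noteq> UNIV"
    using uncountable_UNIV_omega1 by metis
  then obtain b where "b \<notin> (\<Union>a\<in>A. {..a})" by blast
  then show ?thesis
    using that[of b] by (auto simp: not_le)
qed

lemma ex_greater_omega1: "\<exists>b. (a::omega1) < b"
  by (rule countable_imp_strictly_bounded_omega1[of "{a}"]) auto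

text \<open>The limit is the least upper bound, which exists because the order is a well-order in which
  countable sets are bounded.\<close>

lemma incseq_omega1_convergent:
  fixes a :: "nat \<Rightarrow> omega1"
  assumes "mono a"
  obtains l where "a \<longlonglongrightarrow> l" "\<And>n. a n \<le> l"
proof -
  define l where "l = (LEAST l. \<forall>n. a n \<le> l)"
  obtain b where "\<And>n. a n < b"
    by (rule countable_imp_strictly_bounded_omega1[of "range a"]) auto
  then have "\<forall>n. a n \<le> b"
    by (auto intro: less_imp_le)
  then have ub: "\<forall>n. a n \<le> l"
    unfolding l_def by (rule LeastI)
  moreover have "\<exists>n. c < a n" if "c < l" for c
    using not_less_Least[of c "\<lambda>l. \<forall>n. a n \<le> l"] that by (auto simp: l_def not_le)
  ultimately have "a \<longlonglongrightarrow> l"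
    using assms by (intro increasing_tendsto)
      (auto simp: eventually_sequentially, meson less_le_trans monoD)
  then show ?thesis using that ub by blast
qed

text \<open>Starting at \<open>b\<close>, each stage picks an element of every \<open>C n\<close> above the previous stage, and the
  next stage lies above all these elements. The limit of the stages is then also the limit of a
  sequence in \<open>C n\<close>, for each \<open>n\<close>.\<close>

lemma unbounded_INT_club:
  fixes C :: "nat \<Rightarrow> omega1 set"
  assumes club: "\<And>n. club (C n)"
  obtains a where "b < a" "\<And>n. a \<in> C n"
proof -
  have gt: "\<exists>c\<in>C n. x < c" for n x
    using club[of n] unfolding club_def bdd_above_def by (metis not_le)
  define c where "c x n = (SOME c. c \<in> C n \<and> x < c)" for x n
  have c: "c x n \<in> C n" "x < c x n" for x n
    using someI_ex[of "\<lambda>c. c \<in> C n \<and> x < c"] gt[of n x] unfolding c_def by blast+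
  have "\<exists>y. \<forall>n. c x n < y" for x
    by (rule countable_imp_strictly_bounded_omega1[of "range (c x)"]) auto
  then obtain up where up: "\<And>x n. c x n < up x"
    by metis
  define a where "a k = (up ^^ k) b" for k
  have a_Suc: "a (Suc k) = up (a k)" for k by (simp add: a_def)
  have ac: "a k < c (a k) n" "c (a k) n < a (Suc k)" for k n
    using c up by (auto simp: a_Suc)
  have "mono a"
    using ac by (intro mono_iff_le_Suc[THEN iffD2]) (meson less_imp_le order.strict_trans)
  then obtain l where l: "a \<longlonglongrightarrow> l" "\<And>k. a k \<le> l"
    by (rule incseq_omega1_convergent) blast
  have "l \<in> C n" for n
  proof (rule Lim_in_closed_set)
    show "closed (C n)" using club by (simp add: club_def)
    show "(\<lambda>k. c (a k) n) \<longlonglongrightarrow> l"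
      by (rule tendsto_sandwich[OF _ _ l(1) LIMSEQ_Suc[OF l(1)]])
        (use ac in \<open>auto intro!: always_eventually less_imp_le\<close>)
  qed (use c in auto)
  moreover have "b < l"
    using ac[of 0 0] l(2)[of "Suc 0"] by (simp add: a_def)
  ultimately show ?thesis using that by blast
qed

section \<open>The long ray is a linear continuum\<close>

abbreviation lr :: "omega1 \<Rightarrow> real \<Rightarrow> longray"
  where "lr a r \<equiv> Abs_longray (a, r)"

abbreviation ordpart :: "longray \<Rightarrow> omega1"
  where "ordpart x \<equiv> fst (Rep_longray x)"

abbreviation realpart :: "longray \<Rightarrow> real"
  where "realpart x \<equiv> snd (Rep_longray x)"

lemma realpart_bounds: "0 \<le> realpart x" "realpart x < 1"
  using Rep_longray[of x] by auto

lemma Rep_lr [simp]: "0 \<le> r \<Longrightarrow> r < 1 \<Longrightarrow> Rep_longray (lr a r) = (a, r)"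
  by (rule Abs_longray_inverse) auto

lemma Rep_longray_of [simp]: "Rep_longray (longray_of a) = (a, 0)"
  by (simp add: longray_of_def)

lemma zero_omega1_le: "0 \<le> (a::omega1)"
  by (simp add: zero_omega1_def Least_le)

lemma zero_longray_le: "0 \<le> (x::longray)"
  using zero_omega1_le[of "ordpart x"] realpart_bounds[of x]
  by (auto simp: zero_longray_def less_eq_longray_def)

lemma less_longray_of: "ordpart x < a \<Longrightarrow> x < longray_of a"
  by (simp add: less_longray_def)

lemma ex_longray_of_greater: "\<exists>a. x < longray_of a"
  using ex_greater_omega1 less_longray_of by blast

instantiation longray :: linear_continuum
begin

definition inf_longray :: "longray \<Rightarrow> longray \<Rightarrow> longray" where "inf_longray = min"
definition sup_longray :: "longray \<Rightarrow> longray \<Rightarrow> longray" where "sup_longray = max"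

text \<open>In a lexicographic product the infimum is computed coordinate by coordinate: the least
  ordinal that occurs, and above it the infimum of the second coordinates. Suprema are the
  infima of the sets of upper bounds.\<close>

definition Inf_longray :: "longray set \<Rightarrow> longray"
  where "Inf_longray X = (let a = (LEAST a. a \<in> ordpart ` X) in
    lr a (Inf (realpart ` {x \<in> X. ordpart x = a})))"

definition Sup_longray :: "longray set \<Rightarrow> longray"
  where "Sup_longray X = Inf {y. \<forall>x\<in>X. x \<le> y}"

instance
proof
  fix x y z :: longray and X :: "longray set"
  show "inf x y \<le> x" "inf x y \<le> y" "x \<le> y \<Longrightarrow> x \<le> z \<Longrightarrow> x \<le> inf y z"
    "x \<le> sup x y" "y \<le> sup x y" "y \<le> x \<Longrightarrow> z \<le> x \<Longrightarrow> sup y z \<le> x"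
    by (auto simp: inf_longray_def sup_longray_def)
  have Inf_rep: "\<exists>x\<in>X. \<exists>r. Inf X = lr (ordpart x) r \<and> 0 \<le> r \<and> r \<le> realpart x \<and>
      (\<forall>y\<in>X. ordpart x \<le> ordpart y) \<and> (\<forall>y\<in>X. ordpart y = ordpart x \<longrightarrow> r \<le> realpart y) \<and>
      (\<forall>s. (\<forall>y\<in>X. ordpart y = ordpart x \<longrightarrow> s \<le> realpart y) \<longrightarrow> s \<le> r)"
    if ne: "X \<noteq> {}" for X :: "longray set"
  proof -
    define a where "a = (LEAST a. a \<in> ordpart ` X)"
    define R where "R = realpart ` {x \<in> X. ordpart x = a}"
    obtain z where "z \<in> X" using ne by blast
    have "a \<in> ordpart ` X"
      unfolding a_def by (rule LeastI[of _ "ordpart z"]) (use \<open>z \<in> X\<close> in auto)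
    then obtain x where x: "x \<in> X" "ordpart x = a" by auto
    have le: "a \<le> ordpart y" if "y \<in> X" for y
      unfolding a_def using that by (intro Least_le) auto
    have bR: "bdd_below R" unfolding R_def
      by (rule bdd_belowI[of _ 0]) (use realpart_bounds in auto)
    have neR: "realpart x \<in> R" using x by (auto simp: R_def)
    have I: "Inf X = lr a (Inf R)"
      by (simp add: Inf_longray_def a_def R_def Let_def)
    have "0 \<le> Inf R"
      using neR realpart_bounds by (intro cInf_greatest) (auto simp: R_def)
    moreover have "Inf R \<le> realpart y" if "y \<in> X" "ordpart y = a" for y
      by (rule cInf_lower[OF _ bR]) (use that in \<open>auto simp: R_def\<close>)
    moreover have "s \<le> Inf R" if "\<forall>y\<in>X. ordpart y = a \<longrightarrow> s \<le> realpart y" for s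
      using neR that by (intro cInf_greatest) (auto simp: R_def)
    ultimately show ?thesis
      using x le I by (intro bexI[of _ x] exI[of _ "Inf R"]) auto
  qed
  have Inf_lower: "Inf X \<le> x" if mem: "x \<in> X" for x and X :: "longray set"
  proof -
    have ne: "X \<noteq> {}" using mem by blast
    obtain z r where z: "z \<in> X" "Inf X = lr (ordpart z) r" "0 \<le> r" "r \<le> realpart z"
      and le: "ordpart z \<le> ordpart x" and eq: "ordpart x = ordpart z \<Longrightarrow> r \<le> realpart x"
      using Inf_rep[OF ne] mem by blast
    have "r < 1" using z realpart_bounds[of z] by simp
    then show ?thesis
      using z le eq by (cases "ordpart x = ordpart z") (auto simp: less_eq_longray_def)
  qed
  then show "Inf X \<le> x" if "x \<in> X" "bdd_below X" using that by blast
  show Inf_greatest: "z \<le> Inf X" if ne: "X \<noteq> {}" and *: "\<And>x. x \<in> X \<Longrightarrow> z \<le> x"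
    for z and X :: "longray set"
  proof -
    obtain x r where x: "x \<in> X" "Inf X = lr (ordpart x) r" "0 \<le> r" "r \<le> realpart x"
      and g: "\<And>s. (\<forall>y\<in>X. ordpart y = ordpart x \<longrightarrow> s \<le> realpart y) \<Longrightarrow> s \<le> r"
      using Inf_rep[OF ne] by blast
    have r1: "r < 1" using x realpart_bounds[of x] by simp
    show ?thesis
    proof (cases "ordpart z = ordpart x")
      case True
      have "realpart z \<le> realpart y" if "y \<in> X" "ordpart y = ordpart x" for y
        using *[OF that(1)] that(2) True by (auto simp: less_eq_longray_def)
      then have "realpart z \<le> r" by (intro g) blast
      then show ?thesis using True x r1 by (simp add: less_eq_longray_def)
    next
      case False
      then show ?thesis using *[OF x(1)] x r1 by (auto simp: less_eq_longray_def)
    qed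
  qed
  show "x \<le> Sup X" if "x \<in> X" "bdd_above X"
    unfolding Sup_longray_def using that by (intro Inf_greatest) (auto simp: bdd_above_def)
  show "Sup X \<le> z" if "X \<noteq> {}" "\<And>x. x \<in> X \<Longrightarrow> x \<le> z"
    unfolding Sup_longray_def using that by (intro Inf_lower) auto
  show "\<exists>z. x < z \<and> z < y" if "x < y"
  proof (cases "ordpart x = ordpart y")
    case True
    then show ?thesis
      using that realpart_bounds[of x] realpart_bounds[of y]
      by (intro exI[of _ "lr (ordpart x) ((realpart x + realpart y) / 2)"])
        (auto simp: less_longray_def field_simps)
  next
    case False
    then show ?thesis
      using that realpart_bounds[of x]
      by (intro exI[of _ "lr (ordpart x) ((realpart x + 1) / 2)"])
        (auto simp: less_longray_def field_simps)
  qed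
  show "\<exists>a b :: longray. a \<noteq> b"
    using ex_longray_of_greater less_irrefl by metis
qed

end

instance longray :: linear_continuum_topology ..

lemma bdd_above_longray_iff: "bdd_above X \<longleftrightarrow> (\<exists>a. \<forall>x\<in>X. x \<le> longray_of a)"
  unfolding bdd_above_def using ex_longray_of_greater by (meson less_imp_le order_trans)

section \<open>Extending maps into the long ray\<close>

lemma continuous_map_order_topologyI:
  fixes f :: "'a \<Rightarrow> 'b::linorder_topology"
  assumes "\<And>c. openin X {x \<in> topspace X. c < f x}"
    and "\<And>c. openin X {x \<in> topspace X. f x < c}"
  shows "continuous_map X euclidean f"
proof -
  have "openin X {x \<in> topspace X. f x \<in> W}" if "open W" for W
    using that unfolding open_generated_order
  proof (induction rule: generate_topology.induct)
    case UNIV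
    then show ?case by simp
  next
    case (Int V W)
    have "{x \<in> topspace X. f x \<in> V \<inter> W} = {x \<in> topspace X. f x \<in> V} \<inter> {x \<in> topspace X. f x \<in> W}"
      by blast
    then show ?case using Int by auto
  next
    case (UN K)
    have "{x \<in> topspace X. f x \<in> \<Union>K} = (\<Union>W\<in>K. {x \<in> topspace X. f x \<in> W})"
      by blast
    then show ?case using UN by auto
  next
    case (Basis W)
    then show ?case using assms by auto
  qed
  then show ?thesis
    by (simp add: continuous_map_def)
qed

text \<open>The coordinate along the unit interval that starts at \<open>a\<close>, constant before and after it.\<close>

definition clamp :: "omega1 \<Rightarrow> longray \<Rightarrow> real"
  where "clamp a x = (if ordpart x < a then 0 else if ordpart x = a then realpart x else 1)"

lemma clamp_bounds: "0 \<le> clamp a x" "clamp a x \<le> 1"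
  using realpart_bounds[of x] by (auto simp: clamp_def)

lemma clamp_mono: "x \<le> y \<Longrightarrow> clamp a x \<le> clamp a y"
  using realpart_bounds[of x] realpart_bounds[of y]
  by (auto simp: clamp_def less_eq_longray_def)

lemma continuous_clamp: "continuous_on UNIV (clamp a)"
proof -
  have "continuous_map euclidean euclidean (clamp a)"
  proof (rule continuous_map_order_topologyI)
    fix c :: real
    have "{x. c < clamp a x} = (if c < 0 then UNIV else if c < 1 then {lr a c<..} else {})"
      using realpart_bounds clamp_bounds(2)[of a]
      by (auto simp: clamp_def less_longray_def not_less split: if_splits intro: less_le_trans)
        (metis not_less order.strict_trans2 less_imp_le order_trans)+
    then show "openin euclidean {x \<in> topspace euclidean. c < clamp a x}" by simp
    \<comment> \<open>For \<open>c = 1\<close> the sublevel set consists of the points before the successor \<open>b\<close> of \<open>a\<close>.\<close>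
    obtain b where b: "a < b" "\<And>y. a < y \<Longrightarrow> b \<le> y"
      using LeastI_ex[OF ex_greater_omega1[of a]] Least_le[of "\<lambda>b. a < b"] by blast
    have "{x. clamp a x < c} = (if c \<le> 0 then {} else if c < 1 then {..<lr a c}
        else if c = 1 then {..<lr b 0} else UNIV)"
    proof -
      consider "c \<le> 0" | "0 < c" "c < 1" | "c = 1" | "1 < c" by linarith
      then show ?thesis
      proof cases
        case 1
        then show ?thesis using clamp_bounds(1)[of a] by (auto simp: not_less intro: order_trans)
      next
        case 2
        then show ?thesis by (auto simp: clamp_def less_longray_def)
      next
        case 3
        have "clamp a x < 1 \<longleftrightarrow> ordpart x < b" for x
          using realpart_bounds[of x] b by (auto simp: clamp_def not_less)
        moreover have "x < lr b 0 \<longleftrightarrow> ordpart x < b" for x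
          using realpart_bounds(1)[of x] by (auto simp: less_longray_def)
        ultimately show ?thesis
          using 3 by auto
      next
        case 4
        then show ?thesis using clamp_bounds(2)[of a] by (auto intro: le_less_trans)
      qed
    qed
    then show "openin euclidean {x \<in> topspace euclidean. clamp a x < c}" by simp
  qed
  then show ?thesis by simp
qed

text \<open>Only countably many of the unit intervals that make up the long ray lie below a given
  ordinal, so the sum of their coordinates with weights \<open>1/2, 1/4, \<dots>\<close> is a
  continuous function that increases strictly up to that ordinal.\<close>

lemma longray_initial_segment_embeds_in_real:
  obtains \<phi> :: "longray \<Rightarrow> real"
  where "continuous_on UNIV \<phi>" "mono \<phi>" "strict_mono_on {..longray_of a} \<phi>"
proof -
  define b where "b = from_nat_into {..a}"
  have cA: "countable {..a}"
    using countable_lessThan_omega1[of a]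
    by (simp flip: ivl_disj_un_singleton(2))
  have "range b = {..a}"
    unfolding b_def by (rule range_from_nat_into[OF _ cA]) auto
  define f where "f n x = (1/2) ^ Suc n * clamp (b n) x" for n x
  define \<phi> where "\<phi> x = (\<Sum>n. f n x)" for x
  have f: "0 \<le> f n x" "f n x \<le> (1/2) ^ Suc n" for n x
    using clamp_bounds[of "b n" x] by (auto simp: f_def intro: mult_left_le)
  have sg: "summable (\<lambda>n. (1/2::real) ^ Suc n)"
    by (intro summable_Suc_iff[THEN iffD2] summable_geometric) simp
  have sf: "summable (\<lambda>n. f n x)" for x
    by (rule summable_comparison_test'[OF sg]) (use f in auto)
  have f_mono: "x \<le> y \<Longrightarrow> f n x \<le> f n y" for n x y
    by (auto simp: f_def intro!: mult_left_mono clamp_mono)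
  show ?thesis
  proof
    have "uniform_limit UNIV (\<lambda>n x. \<Sum>k<n. f k x) \<phi> sequentially"
      unfolding \<phi>_def by (rule Weierstrass_m_test[OF _ sg]) (use f in auto)
    then show "continuous_on UNIV \<phi>"
      by (rule uniform_limit_theorem[rotated])
        (auto simp: f_def intro!: always_eventually continuous_intros continuous_clamp)
    show "mono \<phi>"
      unfolding \<phi>_def by (intro monoI suminf_le f_mono sf)
    show "strict_mono_on {..longray_of a} \<phi>"
    proof (rule strict_mono_onI)
      fix x y assume xy: "x \<in> {..longray_of a}" "y \<in> {..longray_of a}" "x < y"
      then have "ordpart x \<in> range b"
        by (auto simp: \<open>range b = {..a}\<close> less_eq_longray_def)
      then obtain n where n: "b n = ordpart x" by force
      have "clamp (ordpart x) x < clamp (ordpart x) y"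
        using xy(3) realpart_bounds[of x] by (auto simp: clamp_def less_longray_def)
      then have "f n x < f n y"
        by (simp add: f_def n)
      then show "\<phi> x < \<phi> y"
        using suminf_pos2[of "\<lambda>n. f n y - f n x" n] f_mono[of x y] xy(3)
        by (simp add: \<phi>_def suminf_diff[OF sf sf, symmetric] summable_diff[OF sf sf])
    qed
  qed
qed

text \<open>By the intermediate value theorem the embedding maps an initial segment onto a real
  interval, so Tietze's theorem transfers.\<close>

lemma Tietze_extension_longray:
  fixes p :: "'a \<Rightarrow> longray"
  assumes X: "normal_space X" and S: "closedin X S"
    and p: "continuous_map (subtopology X S) euclidean p"
    and bdd: "bdd_above (p ` S)"
  obtains q where "continuous_map X euclidean q" "\<And>x. x \<in> S \<Longrightarrow> q x = p x"
proof -
  obtain a where a: "\<And>x. x \<in> S \<Longrightarrow> p x \<le> longray_of a"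
    using bdd by (auto simp: bdd_above_longray_iff)
  let ?c = "longray_of a"
  obtain \<phi> :: "longray \<Rightarrow> real" where \<phi>: "continuous_on UNIV \<phi>" "mono \<phi>"
    and sm: "strict_mono_on {..?c} \<phi>"
    by (rule longray_initial_segment_embeds_in_real)
  have "continuous_map (subtopology X S) euclidean (\<phi> \<circ> p)"
    using p \<phi>(1) by (intro continuous_map_compose[of _ euclidean]) auto
  moreover have "(\<phi> \<circ> p) ` S \<subseteq> {\<phi> 0..\<phi> ?c}"
    using a monoD[OF \<phi>(2)] zero_longray_le by auto
  ultimately obtain g where g: "continuous_map X euclidean g"
    "\<And>x. x \<in> S \<Longrightarrow> g x = \<phi> (p x)" "g ` topspace X \<subseteq> {\<phi> 0..\<phi> ?c}"
    using Tietze_extension_closed_real_interval[OF X S, of "\<phi> \<circ> p" "\<phi> 0" "\<phi> ?c"]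
      monoD[OF \<phi>(2) zero_longray_le] by (metis comp_apply)
  have "\<exists>z\<le>?c. \<phi> z = g x" if "x \<in> topspace X" for x
    using IVT'[of \<phi> 0 "g x" ?c] that g(3) zero_longray_le continuous_on_subset[OF \<phi>(1)]
    by auto
  then obtain q where q: "\<And>x. x \<in> topspace X \<Longrightarrow> q x \<le> ?c \<and> \<phi> (q x) = g x"
    by metis
  have less_iff: "z < z' \<longleftrightarrow> \<phi> z < \<phi> z'" if "z \<le> ?c" "z' \<le> ?c" for z z'
    using sm that by (auto simp: strict_mono_on_less)
  show ?thesis
  proof
    show "continuous_map X euclidean q"
    proof (rule continuous_map_order_topologyI)
      fix c :: longray
      have "{x \<in> topspace X. c < q x} = (if c \<le> ?c then {x \<in> topspace X. g x \<in> {\<phi> c<..}} else {})"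
        using q less_iff by auto (meson less_imp_le order_trans)
      then show "openin X {x \<in> topspace X. c < q x}"
        using openin_continuous_map_preimage[OF g(1), of "{\<phi> c<..}"] by simp
      have "{x \<in> topspace X. q x < c} = (if c \<le> ?c then {x \<in> topspace X. g x \<in> {..<\<phi> c}} else topspace X)"
        using q less_iff by auto (meson not_le le_less_trans)
      then show "openin X {x \<in> topspace X. q x < c}"
        using openin_continuous_map_preimage[OF g(1), of "{..<\<phi> c}"] by simp
    qed
    show "q x = p x" if "x \<in> S" for x
    proof -
      have "x \<in> topspace X" using that closedin_subset[OF S] by blast
      then show ?thesis
        using q[of x] g(2)[OF that] less_iff[of "q x" "p x"] less_iff[of "p x" "q x"] a[OF that]
        by (metis less_irrefl linorder_neqE)
    qed
  qed
qed

section \<open>Homotopies seen from a functionally narrow subspace\<close>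

lemma longray_of_less_iff [simp]: "longray_of a < longray_of b \<longleftrightarrow> a < b"
  by (simp add: less_longray_def)

text \<open>The homotopy only has to be continuous in each variable separately.\<close>

lemma unbounded_on_narrow_homotopy_invariant:
  fixes H :: "real \<Rightarrow> 'a \<Rightarrow> longray"
  assumes narrow: "functionally_narrow M U D" and D: "\<And>a. \<not> D \<subseteq> U a"
    and cont1: "\<And>t. t \<in> {0..1} \<Longrightarrow> continuous_map M euclidean (H t)"
    and cont2: "\<And>x. x \<in> D \<Longrightarrow> continuous_on {0..1} (\<lambda>t. H t x)"
    and unbdd: "\<not> bdd_above (H 0 ` D)"
  shows "\<not> bdd_above (H 1 ` D)"
proof
  assume bdd: "bdd_above (H 1 ` D)"
  define T where "T = {t \<in> {0..1}. \<not> bdd_above (H t ` D)}"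
  define B where "B = {t \<in> {0..1}. bdd_above (H t ` D)}"
  have lim: "(\<lambda>n. H (t n) x) \<longlonglongrightarrow> H l x"
    if "x \<in> D" "\<And>n. t n \<in> {0..1}" "t \<longlonglongrightarrow> l" "l \<in> {0..1}" for t l x
    using continuous_on_tendsto_compose[OF cont2[OF that(1)] that(3,4)] that(2) by simp
  have lim_in: "l \<in> {0..1}" if "\<And>n. t n \<in> {0..1::real}" "t \<longlonglongrightarrow> l" for t l
    using closed_sequentially[OF closed_atLeastAtMost that(1) that(2)] .
  \<comment> \<open>Countably many bounds have a common bound, which survives the limit.\<close>
  have "closed B"
    unfolding closed_sequential_limits
  proof (intro allI impI, elim conjE)
    fix t l assume "\<forall>n. t n \<in> B" and tl: "t \<longlonglongrightarrow> l"
    then have t: "t n \<in> {0..1}" "bdd_above (H (t n) ` D)" for n by (auto simp: B_def)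
    have l: "l \<in> {0..1}" by (rule lim_in[OF t(1) tl])
    obtain b where b: "\<And>n x. x \<in> D \<Longrightarrow> H (t n) x \<le> longray_of (b n)"
      using t(2) unfolding bdd_above_longray_iff ball_simps by metis
    obtain c where c: "\<And>n. b n < c"
      by (rule countable_imp_strictly_bounded_omega1[of "range b"]) auto
    have "H l x \<le> longray_of c" if "x \<in> D" for x
    proof (rule tendsto_upperbound[OF lim[OF that t(1) tl l]])
      show "\<forall>\<^sub>F n in sequentially. H (t n) x \<le> longray_of c"
        using b[OF that] c by (intro always_eventually) (meson less_imp_le longray_of_less_iff order_trans)
    qed simp
    then have "bdd_above (H l ` D)" by (rule bdd_aboveI2)
    then show "l \<in> B" using l by (simp add: B_def)
  qed
  \<comment> \<open>Outside \<open>U a\<close>, for \<open>a\<close> in all the clubs given by narrowness, the lower bound \<open>a\<close> survives the limit.\<close>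
  moreover have "closed T"
    unfolding closed_sequential_limits
  proof (intro allI impI, elim conjE)
    fix t l assume "\<forall>n. t n \<in> T" and tl: "t \<longlonglongrightarrow> l"
    then have t: "t n \<in> {0..1}" "\<not> bdd_above (H (t n) ` D)" for n by (auto simp: T_def)
    have l: "l \<in> {0..1}" by (rule lim_in[OF t(1) tl])
    define C where "C n = {a. H (t n) ` (D - U a) \<subseteq> {longray_of a..}}" for n
    have club: "club (C n)" for n
      using narrow cont1[OF t(1)[of n]] t(2)[of n] by (simp add: functionally_narrow_def C_def)
    have "\<exists>x\<in>D. longray_of b < H l x" for b
    proof -
      obtain a where a: "b < a" "\<And>n. a \<in> C n"
        by (rule unbounded_INT_club[where C = C and b = b, OF club]) blast
      obtain x where x: "x \<in> D" "x \<notin> U a" using D by blast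
      have "longray_of a \<le> H l x"
      proof (rule tendsto_lowerbound[OF lim[OF x(1) t(1) tl l]])
        show "\<forall>\<^sub>F n in sequentially. longray_of a \<le> H (t n) x"
          using a(2) x by (intro always_eventually) (auto simp: C_def)
      qed simp
      then show ?thesis using a(1) x(1) by (meson less_le_trans longray_of_less_iff)
    qed
    then show "l \<in> T" using l by (auto simp: T_def bdd_above_longray_iff) (meson not_le)
  qed
  moreover have "{0..1} \<subseteq> T \<union> B" "T \<inter> B \<inter> {0..1} = {}" "0 \<in> T" "1 \<in> B"
    using unbdd bdd by (auto simp: T_def B_def)
  ultimately show False
    using connected_Icc[of 0 "1::real"] unfolding connected_closed
    by (metis IntI atLeastAtMost_iff empty_iff order_refl zero_le_one)
qed

section \<open>An unbounded map from a Type I space to the long ray\<close>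

lemma manifold_imp_locally_compact_space:
  assumes "manifold X"
  shows "locally_compact_space X"
  unfolding locally_compact_space_def
proof
  fix x assume x: "x \<in> topspace X"
  then obtain n W V where W: "openin X W" "x \<in> W" "W \<subseteq> V" "V \<subseteq> topspace X"
    and hom: "subtopology X V homeomorphic_space Euclidean_space n"
    using assms unfolding manifold_def by meson
  have "locally_compact_space (subtopology X V)"
    using homeomorphic_locally_compact_space[OF hom] locally_compact_Euclidean_space by blast
  then obtain G K where GK: "openin (subtopology X V) G" "compactin (subtopology X V) K" "x \<in> G" "G \<subseteq> K"
    using W unfolding locally_compact_space_def by (metis subsetD topspace_subtopology_subset)
  \<comment> \<open>Open sets of \<open>V\<close> need not be open in \<open>X\<close>, but their traces on the open set \<open>W\<close> are.\<close>
  have "openin X (G \<inter> W)"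
  proof -
    obtain G' where "openin X G'" "G = G' \<inter> V" using GK(1) by (auto simp: openin_subtopology)
    then have "G \<inter> W = G' \<inter> W" using W by blast
    then show ?thesis using \<open>openin X G'\<close> W(1) by auto
  qed
  then show "\<exists>G K. openin X G \<and> compactin X K \<and> x \<in> G \<and> G \<subseteq> K"
    using GK W by (meson IntI compactin_subtopology inf.coboundedI1)
qed

text \<open>The closure of \<open>U b\<close> is regular and Lindelof, hence normal, even if \<open>X\<close> is not. A Urysohn function
  on it that is \<open>1\<close> outside \<open>U b\<close> extends by the constant \<open>1\<close>.\<close>

lemma type_I_cover_Urysohn:
  assumes reg: "regular_space X" and cover: "type_I_cover X U" and ab: "a < b"
  obtains r :: "'a \<Rightarrow> real" where "continuous_map X euclidean r"
    "\<And>x. x \<in> topspace X \<Longrightarrow> 0 \<le> r x \<and> r x \<le> 1"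
    "\<And>x. x \<in> U a \<Longrightarrow> r x = 0" "\<And>x. x \<notin> U b \<Longrightarrow> r x = 1"
proof -
  define Y where "Y = X closure_of U b"
  have opn: "openin X (U c)" and lin: "Lindelof_space (subtopology X (X closure_of U c))" for c
    using cover by (auto simp: type_I_cover_def)
  have clo: "X closure_of U a \<subseteq> U b"
    using cover ab by (auto simp: type_I_cover_def)
  have sub: "U c \<subseteq> X closure_of U c" for c
    by (simp add: closure_of_subset openin_subset opn)
  have Ytop: "topspace (subtopology X Y) = Y"
    using closure_of_subset_topspace[of X "U b"] by (simp add: Y_def inf.absorb2)
  have normal: "normal_space (subtopology X Y)"
    unfolding Y_def by (intro regular_Lindelof_imp_normal_space regular_space_subtopology reg lin)
  have cS: "closedin (subtopology X Y) (X closure_of U a)"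
    using clo sub[of b] by (intro closedin_subset_topspace) (auto simp: Y_def)
  have cT: "closedin (subtopology X Y) (Y - U b)"
  proof -
    have "closedin (subtopology X Y) (Y \<inter> (topspace X - U b))"
      by (intro closedin_subtopology_Int_closed closedin_diff closedin_topspace opn)
    moreover have "Y \<inter> (topspace X - U b) = Y - U b"
      using Ytop by auto
    ultimately show ?thesis by simp
  qed
  obtain f where f: "continuous_map (subtopology X Y) (top_of_set {0..1::real}) f"
    "f ` (X closure_of U a) \<subseteq> {0}" "f ` (Y - U b) \<subseteq> {1}"
    by (rule Urysohn_lemma[OF normal cS cT, of 0 1]) (use clo in \<open>auto simp: disjnt_def\<close>)
  define r where "r x = (if x \<in> U b then f x else 1)" for x
  show ?thesis
  proof
    show "continuous_map X euclidean r"
    proof (rule pasting_lemma_closed[of "{True, False}" _ "\<lambda>i. if i then Y else topspace X - U b"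
          _ "\<lambda>i. if i then f else (\<lambda>_. 1)"])
      show "continuous_map (subtopology X (if i then Y else topspace X - U b)) euclidean
        (if i then f else (\<lambda>_. 1))" for i
        using f(1) by (auto simp: continuous_map_in_subtopology)
      show "\<exists>j. j \<in> {True, False} \<and> x \<in> (if j then Y else topspace X - U b) \<and>
        r x = (if j then f else (\<lambda>_. 1)) x" if "x \<in> topspace X" for x
        using that sub[of b] by (cases "x \<in> U b") (auto simp: r_def Y_def)
    qed (use f(3) opn in \<open>auto simp: Y_def image_subset_iff split: if_splits\<close>)
    show "r x = 0" if "x \<in> U a" for x
      using that f(2) sub[of a] clo by (auto simp: r_def)
    show "0 \<le> r x \<and> r x \<le> 1" if "x \<in> topspace X" for x
      using f(1) sub[of b] Ytop by (auto simp: r_def Y_def continuous_map_in_subtopology)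
    show "r x = 1" if "x \<notin> U b" for x
      using that by (simp add: r_def)
  qed
qed

text \<open>Let \<open>r a\<close> be a Urysohn function that rises from \<open>0\<close> on \<open>U a\<close> to \<open>1\<close> outside the next set of the
  cover. At a point \<open>x\<close>, the values \<open>r a x\<close> are \<open>1\<close>, then possibly one intermediate value, then
  \<open>0\<close>, as \<open>a\<close> increases; they are the coordinates of a point \<open>s x\<close> of the long ray. Every
  comparison of \<open>s x\<close> with a fixed point can be read off from these coordinates, which gives
  continuity.\<close>

lemma type_I_cover_unbounded_map:
  assumes reg: "regular_space X" and cover: "type_I_cover X U"
  obtains s :: "'a \<Rightarrow> longray" where "continuous_map X euclidean s"
    "\<And>a. \<exists>b. \<forall>x \<in> topspace X - U b. longray_of a < s x"
proof -
  define suc where "suc a = (LEAST b. (a::omega1) < b)" for a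
  have suc: "a < suc a" "\<And>b. a < b \<Longrightarrow> suc a \<le> b" for a
    using LeastI_ex[OF ex_greater_omega1[of a]] Least_le[of "\<lambda>b. a < b"] by (auto simp: suc_def)
  have mono: "U a \<subseteq> U b" if "a \<le> b" for a b
  proof (cases "a = b")
    case False
    have "U a \<subseteq> X closure_of U a"
      using cover by (intro closure_of_subset openin_subset) (auto simp: type_I_cover_def)
    then show ?thesis
      using cover that False unfolding type_I_cover_def by (meson le_neq_trans order_trans)
  qed simp
  have "\<exists>r :: 'a \<Rightarrow> real. continuous_map X euclidean r \<and> (\<forall>x \<in> topspace X. 0 \<le> r x \<and> r x \<le> 1) \<and>
      (\<forall>x \<in> U a. r x = 0) \<and> (\<forall>x. x \<notin> U (suc a) \<longrightarrow> r x = 1)" for a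
    by (rule type_I_cover_Urysohn[OF reg cover suc(1)[of a]]) blast
  then obtain r :: "omega1 \<Rightarrow> 'a \<Rightarrow> real" where r: "\<And>a. continuous_map X euclidean (r a)"
    "\<And>a x. x \<in> topspace X \<Longrightarrow> 0 \<le> r a x" "\<And>a x. x \<in> topspace X \<Longrightarrow> r a x \<le> 1"
    "\<And>a x. x \<in> U a \<Longrightarrow> r a x = 0" "\<And>a x. x \<notin> U (suc a) \<Longrightarrow> r a x = 1"
    by metis
  \<comment> \<open>A point where \<open>r a\<close> is below \<open>1\<close> lies in the next set of the cover, where all later functions vanish.\<close>
  have r0: "r b x = 0" if "r a x < 1" "a < b" for a b x
  proof -
    have "x \<in> U (suc a)" using r(5)[of x a] that(1) by force
    then show ?thesis using mono[OF suc(2)[OF that(2)]] r(4) by blast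
  qed
  define m where "m x = (LEAST a. r a x < 1)" for x
  define s where "s x = lr (m x) (r (m x) x)" for x
  have m: "r (m x) x < 1" if x: "x \<in> topspace X" for x
  proof -
    have "topspace X = (\<Union>a. U a)" using cover by (simp add: type_I_cover_def)
    then obtain a where "x \<in> U a" using x by blast
    then have "r a x < 1" using r(4) by simp
    then show ?thesis unfolding m_def by (rule LeastI)
  qed
  have m_le: "m x \<le> a" if "r a x < 1" for x a
    unfolding m_def using that by (rule Least_le)
  have Rep_s: "Rep_longray (s x) = (m x, r (m x) x)" if "x \<in> topspace X" for x
    using that m r(2) by (simp add: s_def)
  have gt: "c < s x \<longleftrightarrow> realpart c < r (ordpart c) x" if x: "x \<in> topspace X" for c x
  proof -
    consider "m x < ordpart c" | "m x = ordpart c" | "ordpart c < m x" by fastforce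
    then show ?thesis
    proof cases
      case 1
      then have "r (ordpart c) x = 0" using r0 m[OF x] by blast
      then show ?thesis using 1 Rep_s[OF x] realpart_bounds[of c] by (auto simp: less_longray_def)
    next
      case 2
      then show ?thesis using Rep_s[OF x] by (auto simp: less_longray_def)
    next
      case 3
      then have "r (ordpart c) x \<ge> 1" using m_le not_less by (meson leD)
      then show ?thesis using 3 Rep_s[OF x] realpart_bounds[of c] by (auto simp: less_longray_def)
    qed
  qed
  have lt: "s x < c \<longleftrightarrow> r (ordpart c) x < realpart c \<or> (\<exists>a<ordpart c. r a x < 1)"
    if x: "x \<in> topspace X" for c x
  proof -
    consider "m x < ordpart c" | "m x = ordpart c" | "ordpart c < m x" by fastforce
    then show ?thesis
    proof cases
      case 1
      then show ?thesis using m[OF x] Rep_s[OF x] by (auto simp: less_longray_def)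
    next
      case 2
      moreover have "\<not> r a x < 1" if "a < ordpart c" for a
        using m_le[of a x] that 2 by auto
      ultimately show ?thesis using Rep_s[OF x] by (auto simp: less_longray_def)
    next
      case 3
      then have "\<not> r a x < 1" if "a \<le> ordpart c" for a
        using m_le that by (meson leD le_less_trans)
      then show ?thesis
        using 3 Rep_s[OF x] realpart_bounds(2)[of c]
        by (auto simp: less_longray_def dest: less_imp_le intro: less_trans)
    qed
  qed
  show ?thesis
  proof
    show "continuous_map X euclidean s"
    proof (rule continuous_map_order_topologyI)
      fix c
      have "{x \<in> topspace X. c < s x} = {x \<in> topspace X. r (ordpart c) x \<in> {realpart c<..}}"
        using gt by auto
      then show "openin X {x \<in> topspace X. c < s x}"
        using openin_continuous_map_preimage[OF r(1), of "{realpart c<..}" "ordpart c"] by simp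
      have sublevel: "openin X {x \<in> topspace X. r a x \<in> {..<v}}" for a v
        by (rule openin_continuous_map_preimage[OF r(1)]) simp
      have "{x \<in> topspace X. s x < c} = {x \<in> topspace X. r (ordpart c) x \<in> {..<realpart c}} \<union>
          (\<Union>a\<in>{..<ordpart c}. {x \<in> topspace X. r a x \<in> {..<1}})"
        using lt by auto
      also have "openin X \<dots>"
        by (rule openin_Un[OF sublevel openin_Union]) (elim imageE, simp only: sublevel)
      finally show "openin X {x \<in> topspace X. s x < c}" .
    qed
    show "\<exists>b. \<forall>x \<in> topspace X - U b. longray_of a < s x" for a
      using gt[of _ "longray_of a"] r(5)[of _ a] by (intro exI[of _ "suc a"]) auto
  qed
qed

lemma non_Lindelof_closed_imp_unbounded:
  assumes cover: "type_I_cover X U" and D: "closedin X D" "\<not> Lindelof_space (subtopology X D)"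
  shows "\<not> D \<subseteq> U a"
proof
  assume "D \<subseteq> U a"
  moreover have "U a \<subseteq> X closure_of U a"
    using cover by (intro closure_of_subset openin_subset) (auto simp: type_I_cover_def)
  ultimately have DY: "D \<subseteq> X closure_of U a" by blast
  have "Lindelof_space (subtopology (subtopology X (X closure_of U a)) D)"
  proof (rule Lindelof_space_closedin_subtopology)
    show "Lindelof_space (subtopology X (X closure_of U a))"
      using cover by (auto simp: type_I_cover_def)
    show "closedin (subtopology X (X closure_of U a)) D"
      by (rule closedin_subset_topspace[OF D(1) DY])
  qed
  then show False
    using D(2) DY by (simp add: subtopology_subtopology inf.absorb2)
qed

section \<open>Cells\<close>

lemma compact_space_cell_disk: "compact_space (cell_disk n)"
proof -
  define B where "B = {x :: nat \<Rightarrow> real. (\<forall>i\<ge>n. x i = 0) \<and> (\<Sum>i<n. (x i)\<^sup>2) \<le> 1}"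
  have "B = (\<Inter>i\<in>{n..}. {x. x i = 0}) \<inter> {x. (\<Sum>i<n. (x i)\<^sup>2) \<le> 1}"
    by (auto simp: B_def)
  also have "closed \<dots>"
    by (intro closed_Int closed_INT ballI closed_Collect_eq closed_Collect_le continuous_intros
        continuous_on_product_coordinates)
  finally have "closedin (powertop_real UNIV) B"
    by (simp add: euclidean_product_topology closed_closedin[symmetric])
  moreover have "compactin (powertop_real UNIV) (PiE UNIV (\<lambda>i. {-1..1}))"
    by (simp add: compactin_PiE)
  moreover have "B \<subseteq> PiE UNIV (\<lambda>i. {-1..1})"
  proof
    fix x assume x: "x \<in> B"
    have "(x i)\<^sup>2 \<le> 1" for i
    proof (cases "i < n")
      case True
      then have "(x i)\<^sup>2 \<le> (\<Sum>i<n. (x i)\<^sup>2)" by (intro member_le_sum) auto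
      then show ?thesis using x by (auto simp: B_def)
    qed (use x in \<open>auto simp: B_def\<close>)
    then show "x \<in> PiE UNIV (\<lambda>i. {-1..1})"
      by (auto simp: abs_square_le_1 abs_le_iff minus_le_iff)
  qed
  ultimately have "compactin (powertop_real UNIV) B"
    using closed_compactin by metis
  moreover have "cell_disk n = subtopology (powertop_real UNIV) B"
    by (simp add: cell_disk_def Euclidean_space_def subtopology_subtopology B_def Int_def)
  ultimately show ?thesis by (simp add: compact_space_subtopology)
qed

lemma Hausdorff_space_cell_disk: "Hausdorff_space (cell_disk n)"
  unfolding cell_disk_def Euclidean_space_def
  by (intro Hausdorff_space_subtopology) (simp add: Hausdorff_space_product_topology)

lemma topspace_cell_disk: "topspace (cell_disk n) = cell_interior n \<union> cell_boundary n"
  by (auto simp: cell_interior_def cell_boundary_def cell_disk_def)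

lemma closedin_cell_boundary: "closedin (cell_disk n) (cell_boundary n)"
proof -
  have "continuous_map (cell_disk n) euclidean (\<lambda>x. \<Sum>i<n. (x i)\<^sup>2)"
    unfolding cell_disk_def Euclidean_space_def
    by (intro continuous_map_from_subtopology)
      (auto simp: euclidean_product_topology intro!: continuous_intros continuous_on_product_coordinates)
  from closedin_continuous_map_preimage[OF this, of "{1}"] show ?thesis
    by (simp add: cell_boundary_def)
qed

abbreviation unit_interval :: "real topology"
  where "unit_interval \<equiv> top_of_set {0..1}"

abbreviation cell_cylinder :: "nat \<Rightarrow> ((nat \<Rightarrow> real) \<times> real) topology"
  where "cell_cylinder n \<equiv> prod_topology (cell_disk n) unit_interval"

lemma compact_space_cell_cylinder: "compact_space (cell_cylinder n)"
  by (simp add: compact_space_prod_topology compact_space_cell_disk compact_space_subtopology)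

lemma normal_space_cell_cylinder: "normal_space (cell_cylinder n)"
  by (intro compact_Hausdorff_or_regular_imp_normal_space compact_space_cell_cylinder)
    (simp add: Hausdorff_space_prod_topology Hausdorff_space_cell_disk Hausdorff_space_subtopology)

text \<open>The part of the boundary of the cylinder over a cell on which a homotopy between two given maps is
  prescribed: the wall, where it is known from cells of smaller dimension, and both ends.\<close>

definition cylinder_frame :: "nat \<Rightarrow> ((nat \<Rightarrow> real) \<times> real) set"
  where "cylinder_frame n = cell_boundary n \<times> {0..1} \<union> topspace (cell_disk n) \<times> {0, 1}"

lemma closedin_cylinder_frame: "closedin (cell_cylinder n) (cylinder_frame n)"
  unfolding cylinder_frame_def
  by (intro closedin_Un closedin_prod_Times_iff[THEN iffD2] disjI2)
    (auto simp: closedin_cell_boundary closedin_closed_eq intro: closedin_subset_topspace)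

section \<open>The topology of a CW-complex\<close>

locale CW =
  fixes X :: "'b topology" and E :: "'b set set" and d :: "'b set \<Rightarrow> nat"
    and \<Phi> :: "'b set \<Rightarrow> (nat \<Rightarrow> real) \<Rightarrow> 'b"
  assumes cw: "CW_structure X E d \<Phi>"
begin

definition closed_cell :: "'b set \<Rightarrow> 'b set"
  where "closed_cell e = \<Phi> e ` topspace (cell_disk (d e))"

definition the_cell :: "'b \<Rightarrow> 'b set"
  where "the_cell y = (THE e. e \<in> E \<and> y \<in> e)"

lemma Hausdorff: "Hausdorff_space X"
  and Union_cells: "\<Union>E = topspace X"
  and disjoint: "pairwise disjnt E"
  and continuous_\<Phi>: "e \<in> E \<Longrightarrow> continuous_map (cell_disk (d e)) X (\<Phi> e)"
  and homeomorphic_\<Phi>: "e \<in> E \<Longrightarrow> homeomorphic_map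
      (subtopology (cell_disk (d e)) (cell_interior (d e))) (subtopology X e) (\<Phi> e)"
  and boundary_finite: "e \<in> E \<Longrightarrow>
      \<exists>F\<subseteq>E. finite F \<and> (\<forall>e'\<in>F. d e' < d e) \<and> \<Phi> e ` cell_boundary (d e) \<subseteq> \<Union>F"
  using cw by (simp_all add: CW_structure_def)

lemma weak_topology:
  assumes "A \<subseteq> topspace X" "\<And>e. e \<in> E \<Longrightarrow> closedin X (A \<inter> X closure_of e)"
  shows "closedin X A"
  using cw assms by (simp add: CW_structure_def)

lemma the_cell_eq: "e \<in> E \<Longrightarrow> y \<in> e \<Longrightarrow> the_cell y = e"
  unfolding the_cell_def using disjoint
  by (intro the_equality) (auto simp: pairwise_def disjnt_iff)

lemma the_cell_in: "y \<in> topspace X \<Longrightarrow> the_cell y \<in> E \<and> y \<in> the_cell y"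
  using Union_cells the_cell_eq by blast

lemma image_interior: "e \<in> E \<Longrightarrow> \<Phi> e ` cell_interior (d e) = e"
  and inj_interior: "e \<in> E \<Longrightarrow> inj_on (\<Phi> e) (cell_interior (d e))"
proof -
  assume e: "e \<in> E"
  have *: "topspace (subtopology (cell_disk (d e)) (cell_interior (d e))) = cell_interior (d e)"
    "topspace (subtopology X e) = e"
    using Union_cells e by (auto simp: cell_interior_def)
  show "\<Phi> e ` cell_interior (d e) = e"
    using homeomorphic_imp_surjective_map[OF homeomorphic_\<Phi>[OF e]] * by simp
  show "inj_on (\<Phi> e) (cell_interior (d e))"
    using homeomorphic_imp_injective_map[OF homeomorphic_\<Phi>[OF e]] * by simp
qed

lemma in_cellE:
  assumes "y \<in> topspace X"
  obtains e x where "e \<in> E" "x \<in> cell_interior (d e)" "y = \<Phi> e x"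
proof -
  have "the_cell y \<in> E" "y \<in> the_cell y" using the_cell_in[OF assms] by auto
  then show ?thesis using image_interior[of "the_cell y"] that by blast
qed

lemma \<Phi>_in_topspace: "e \<in> E \<Longrightarrow> x \<in> topspace (cell_disk (d e)) \<Longrightarrow> \<Phi> e x \<in> topspace X"
  using continuous_map_image_subset_topspace[OF continuous_\<Phi>] by blast

lemma the_cell_\<Phi>_interior: "e \<in> E \<Longrightarrow> x \<in> cell_interior (d e) \<Longrightarrow> the_cell (\<Phi> e x) = e"
  using image_interior the_cell_eq by blast

lemma the_cell_\<Phi>_boundary: "e \<in> E \<Longrightarrow> x \<in> cell_boundary (d e) \<Longrightarrow> d (the_cell (\<Phi> e x)) < d e"
proof -
  assume e: "e \<in> E" and x: "x \<in> cell_boundary (d e)"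
  obtain F where F: "F \<subseteq> E" "\<forall>e'\<in>F. d e' < d e" "\<Phi> e ` cell_boundary (d e) \<subseteq> \<Union>F"
    using boundary_finite[OF e] by blast
  then obtain e' where "e' \<in> F" "\<Phi> e x \<in> e'" using x by blast
  then show ?thesis using F the_cell_eq[of e' "\<Phi> e x"] by auto
qed

lemma the_cell_\<Phi>_le: "e \<in> E \<Longrightarrow> x \<in> topspace (cell_disk (d e)) \<Longrightarrow> d (the_cell (\<Phi> e x)) \<le> d e"
  using the_cell_\<Phi>_interior the_cell_\<Phi>_boundary by (fastforce simp: topspace_cell_disk)

lemma cell_subset_closed_cell: "e \<in> E \<Longrightarrow> e \<subseteq> closed_cell e"
  using image_interior by (auto simp: closed_cell_def topspace_cell_disk)

lemma closed_map_\<Phi>: "e \<in> E \<Longrightarrow> closed_map (cell_disk (d e)) X (\<Phi> e)"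
  by (intro continuous_imp_closed_map compact_space_cell_disk Hausdorff continuous_\<Phi>)

lemma closedin_closed_cell: "e \<in> E \<Longrightarrow> closedin X (closed_cell e)"
  using closed_map_\<Phi> by (auto simp: closed_cell_def closed_map_def)

lemma closure_subset_closed_cell: "e \<in> E \<Longrightarrow> X closure_of e \<subseteq> closed_cell e"
  by (intro closure_of_minimal cell_subset_closed_cell closedin_closed_cell)

text \<open>The closure of a cell is contained in the closed cell, so the weak topology reduces closedness of
  preimages to the closed cells, and these carry the quotient topology of the disks.\<close>

lemma continuous_mapI:
  assumes "\<And>e. e \<in> E \<Longrightarrow> continuous_map (cell_disk (d e)) Y (f \<circ> \<Phi> e)"
  shows "continuous_map X Y f"
  unfolding continuous_map_closedin
proof (intro conjI allI impI)
  show "f \<in> topspace X \<rightarrow> topspace Y"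
  proof
    fix y assume "y \<in> topspace X"
    then obtain e x where "e \<in> E" "x \<in> cell_interior (d e)" "y = \<Phi> e x"
      by (rule in_cellE)
    then show "f y \<in> topspace Y"
      using continuous_map_image_subset_topspace[OF assms[of e]] by (auto simp: topspace_cell_disk)
  qed
  fix C assume C: "closedin Y C"
  show "closedin X {y \<in> topspace X. f y \<in> C}"
  proof (rule weak_topology)
    fix e assume e: "e \<in> E"
    have "closedin X (\<Phi> e ` {x \<in> topspace (cell_disk (d e)). (f \<circ> \<Phi> e) x \<in> C})"
      using closed_map_\<Phi>[OF e] closedin_continuous_map_preimage[OF assms[OF e] C]
      by (auto simp: closed_map_def)
    also have "\<Phi> e ` {x \<in> topspace (cell_disk (d e)). (f \<circ> \<Phi> e) x \<in> C} =
        {y \<in> topspace X. f y \<in> C} \<inter> closed_cell e"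
      using \<Phi>_in_topspace[OF e] by (auto simp: closed_cell_def)
    finally have "closedin X ({y \<in> topspace X. f y \<in> C} \<inter> closed_cell e \<inter> X closure_of e)"
      by (rule closedin_Int) simp
    then show "closedin X ({y \<in> topspace X. f y \<in> C} \<inter> X closure_of e)"
      by (simp add: inf.absorb2[OF closure_subset_closed_cell[OF e]] Int_assoc)
  qed auto
qed

definition continuous_on_cell :: "('b \<Rightarrow> real \<Rightarrow> longray) \<Rightarrow> 'b set \<Rightarrow> bool"
  where "continuous_on_cell H e \<longleftrightarrow>
    continuous_map (cell_cylinder (d e)) euclidean (\<lambda>z. H (\<Phi> e (fst z)) (snd z))"

text \<open>A map from a compact space onto a Hausdorff space is a quotient map; this applies to
  \<open>\<Phi> e \<times> id\<close>.\<close>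

lemma continuous_on_closed_cell:
  assumes e: "e \<in> E" and H: "continuous_on_cell H e"
  shows "continuous_map (prod_topology (subtopology X (closed_cell e)) unit_interval) euclidean
    (\<lambda>z. H (fst z) (snd z))"
proof -
  let ?q = "\<lambda>z. (\<Phi> e (fst z), snd z)"
  let ?Y = "prod_topology (subtopology X (closed_cell e)) unit_interval"
  have sub: "closed_cell e \<subseteq> topspace X"
    using closedin_closed_cell[OF e] by (rule closedin_subset)
  have "continuous_map (cell_cylinder (d e)) ?Y ?q"
    unfolding continuous_map_pairwise comp_def fst_conv snd_conv
    by (intro conjI continuous_map_into_subtopology
        continuous_map_compose[OF continuous_map_fst continuous_\<Phi>[OF e], unfolded comp_def]
        continuous_map_snd)
      (auto simp: closed_cell_def)
  moreover have "?q ` topspace (cell_cylinder (d e)) = topspace ?Y"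
    using sub by (auto simp: closed_cell_def image_iff)
  moreover have "Hausdorff_space ?Y"
    by (simp add: Hausdorff_space_prod_topology Hausdorff Hausdorff_space_subtopology)
  ultimately have "quotient_map (cell_cylinder (d e)) ?Y ?q"
    by (intro continuous_imp_quotient_map compact_space_cell_cylinder)
  then show ?thesis
    using H unfolding continuous_on_cell_def
    by (subst continuous_compose_quotient_map_eq[symmetric]) (auto simp: comp_def)
qed

text \<open>By closure-finiteness the boundary of the disk is covered by the preimages of finitely many closed
  cells of smaller dimension. These preimages are closed, so continuity can be checked on each.\<close>

lemma continuous_on_boundary_cylinder:
  assumes e: "e \<in> E" and H: "\<And>e'. e' \<in> E \<Longrightarrow> d e' < d e \<Longrightarrow> continuous_on_cell H e'"
  shows "continuous_map (subtopology (cell_cylinder (d e)) (cell_boundary (d e) \<times> {0..1})) euclidean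
    (\<lambda>z. H (\<Phi> e (fst z)) (snd z))"
proof -
  obtain F where F: "F \<subseteq> E" "finite F" "\<forall>e'\<in>F. d e' < d e" "\<Phi> e ` cell_boundary (d e) \<subseteq> \<Union>F"
    using boundary_finite[OF e] by blast
  let ?Q = "subtopology (cell_cylinder (d e)) (cell_boundary (d e) \<times> {0..1})"
  let ?T = "\<lambda>e'. {z \<in> topspace ?Q. \<Phi> e (fst z) \<in> closed_cell e'}"
  have fst: "continuous_map ?Q X (\<lambda>z. \<Phi> e (fst z))"
    by (intro continuous_map_from_subtopology
        continuous_map_compose[OF continuous_map_fst continuous_\<Phi>[OF e], unfolded comp_def])
  have snd: "continuous_map ?Q unit_interval snd"
    by (intro continuous_map_from_subtopology continuous_map_snd)
  show ?thesis
  proof (rule pasting_lemma_closed[where I = F and T = ?T and f = "\<lambda>_ z. H (\<Phi> e (fst z)) (snd z)"])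
    fix e' assume "e' \<in> F"
    then have e': "e' \<in> E" "continuous_on_cell H e'" using F H by auto
    show "closedin ?Q (?T e')"
      by (rule closedin_continuous_map_preimage[OF fst closedin_closed_cell[OF e'(1)]])
    have "continuous_map (subtopology ?Q (?T e'))
        (prod_topology (subtopology X (closed_cell e')) unit_interval) (\<lambda>z. (\<Phi> e (fst z), snd z))"
      unfolding continuous_map_pairwise comp_def fst_conv snd_conv
      by (intro conjI continuous_map_into_subtopology continuous_map_from_subtopology[OF fst]
          continuous_map_from_subtopology[OF snd]) auto
    from continuous_map_compose[OF this continuous_on_closed_cell[OF e']]
    show "continuous_map (subtopology ?Q (?T e')) euclidean (\<lambda>z. H (\<Phi> e (fst z)) (snd z))"
      by (simp add: comp_def)
  next
    fix z assume z: "z \<in> topspace ?Q"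
    then obtain e' where "e' \<in> F" "\<Phi> e (fst z) \<in> e'" using F(4) by auto
    then show "\<exists>e'. e' \<in> F \<and> z \<in> ?T e' \<and> H (\<Phi> e (fst z)) (snd z) = H (\<Phi> e (fst z)) (snd z)"
      using z F(1) cell_subset_closed_cell by blast
  qed (use F in auto)
qed

text \<open>Prescribed values on the frame extend to the whole cylinder: the frame is compact, so its image
  in the long ray is bounded and Tietze's theorem applies.\<close>

lemma cylinder_extension:
  assumes e: "e \<in> E" and H: "\<And>e'. e' \<in> E \<Longrightarrow> d e' < d e \<Longrightarrow> continuous_on_cell H e'"
    and w0: "continuous_map X euclidean w0" "\<And>y. y \<in> topspace X \<Longrightarrow> H y 0 = w0 y"
    and w1: "continuous_map X euclidean w1" "\<And>y. y \<in> topspace X \<Longrightarrow> H y 1 = w1 y"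
  obtains G where "continuous_map (cell_cylinder (d e)) euclidean G"
    "\<And>x t. (x, t) \<in> cylinder_frame (d e) \<Longrightarrow> G (x, t) = H (\<Phi> e x) t"
proof -
  let ?P = "cell_cylinder (d e)"
  let ?S = "cylinder_frame (d e)"
  let ?Q = "subtopology ?P ?S"
  let ?p = "\<lambda>z. H (\<Phi> e (fst z)) (snd z)"
  define T where "T i = (if i = (0::nat) then cell_boundary (d e) \<times> {0..1}
    else if i = 1 then topspace (cell_disk (d e)) \<times> {0} else topspace (cell_disk (d e)) \<times> {1::real})" for i
  have ST: "?S = T 0 \<union> T 1 \<union> T 2" by (auto simp: T_def cylinder_frame_def)
  have closed_T: "closedin ?P (T i)" for i
    unfolding T_def
    by (auto intro!: closedin_prod_Times_iff[THEN iffD2] disjI2 closedin_subset_topspace closedin_cell_boundary)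
  have end_cont: "continuous_map (subtopology ?P (topspace (cell_disk (d e)) \<times> {c})) euclidean ?p"
    if "continuous_map X euclidean w" "\<And>y. y \<in> topspace X \<Longrightarrow> H y c = w y" for c w
  proof (rule continuous_map_eq)
    show "continuous_map (subtopology ?P (topspace (cell_disk (d e)) \<times> {c})) euclidean (w \<circ> (\<Phi> e \<circ> fst))"
      by (intro continuous_map_from_subtopology continuous_map_compose[OF _ that(1)]
          continuous_map_compose[OF continuous_map_fst continuous_\<Phi>[OF e]])
  qed (use that(2) \<Phi>_in_topspace[OF e] in auto)
  have cont: "continuous_map (subtopology ?P (T i)) euclidean ?p" for i
    using continuous_on_boundary_cylinder[OF e H] end_cont[OF w0] end_cont[OF w1]
    by (simp add: T_def)
  have p: "continuous_map ?Q euclidean ?p"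
  proof (rule pasting_lemma_closed[where I = "{0, 1, 2}" and T = T and f = "\<lambda>_. ?p"])
    show "closedin ?Q (T i)" if "i \<in> {0, 1, 2}" for i
      using that ST by (intro closedin_subset_topspace closed_T) auto
    show "continuous_map (subtopology ?Q (T i)) euclidean ?p" if "i \<in> {0, 1, 2}" for i
    proof -
      have "?S \<inter> T i = T i" using that ST by auto
      then show ?thesis using cont[of i] by (simp add: subtopology_subtopology)
    qed
  qed (use ST in auto)
  have "compact_space ?Q"
    by (metis closedin_compact_space compact_space_cell_cylinder closedin_cylinder_frame compact_space_subtopology)
  then have "compactin euclidean (?p ` topspace ?Q)"
    by (intro image_compactin[OF _ p]) (simp only: compact_space_def)
  moreover have "topspace ?Q = ?S"
    using closedin_subset[OF closedin_cylinder_frame] by (rule topspace_subtopology_subset)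
  ultimately have "compact (?p ` ?S)" by simp
  then have "bdd_above (?p ` ?S)"
    using compact_attains_sup[of "?p ` ?S"] by (cases "?S = {}") (force simp: bdd_above_def)+
  then show ?thesis
    by (rule Tietze_extension_longray[OF normal_space_cell_cylinder closedin_cylinder_frame p])
      (rule that, auto)
qed

section \<open>Homotopies from a CW-complex to the long ray\<close>

text \<open>The end conditions hold on all of \<open>X\<close>, but only the cells of dimension less than \<open>n\<close> carry a
  continuity condition. Working with functions that are defined everywhere avoids subspace
  topologies of skeleta.\<close>

definition skeleton_homotopy :: "('b \<Rightarrow> longray) \<Rightarrow> ('b \<Rightarrow> longray) \<Rightarrow> nat \<Rightarrow> ('b \<Rightarrow> real \<Rightarrow> longray) \<Rightarrow> bool"
  where "skeleton_homotopy w0 w1 n H \<longleftrightarrow>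
    (\<forall>y\<in>topspace X. H y 0 = w0 y \<and> H y 1 = w1 y) \<and> (\<forall>e\<in>E. d e < n \<longrightarrow> continuous_on_cell H e)"

lemma continuous_on_cell_cong:
  assumes "continuous_on_cell H e"
    and "\<And>x t. x \<in> topspace (cell_disk (d e)) \<Longrightarrow> t \<in> {0..1} \<Longrightarrow> H (\<Phi> e x) t = H' (\<Phi> e x) t"
  shows "continuous_on_cell H' e"
  using assms(1) unfolding continuous_on_cell_def
  by (rule continuous_map_eq) (use assms(2) in auto)

text \<open>On the open cells of dimension \<open>n\<close>, the new homotopy is an extension \<open>G e\<close> over the cylinder,
  transported by the characteristic map; elsewhere it is the old one. On the boundary of a disk both
  descriptions agree because \<open>G e\<close> extends the old homotopy.\<close>

lemma skeleton_homotopy_extend: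
  assumes w: "continuous_map X euclidean w0" "continuous_map X euclidean w1"
    and H: "skeleton_homotopy w0 w1 n H"
  obtains H' where "skeleton_homotopy w0 w1 (Suc n) H'"
    "\<And>y. y \<in> topspace X \<Longrightarrow> d (the_cell y) < n \<Longrightarrow> H' y = H y"
proof -
  have ends: "\<And>y. y \<in> topspace X \<Longrightarrow> H y 0 = w0 y" "\<And>y. y \<in> topspace X \<Longrightarrow> H y 1 = w1 y"
    and cells: "\<And>e. e \<in> E \<Longrightarrow> d e < n \<Longrightarrow> continuous_on_cell H e"
    using H by (auto simp: skeleton_homotopy_def)
  have "\<exists>G. continuous_map (cell_cylinder (d e)) euclidean G \<and>
      (\<forall>x t. (x, t) \<in> cylinder_frame (d e) \<longrightarrow> G (x, t) = H (\<Phi> e x) t)"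
    if e: "e \<in> E" and "d e = n" for e
    by (rule cylinder_extension[OF e _ w(1) ends(1) w(2) ends(2)]) (use cells \<open>d e = n\<close> in auto)
  then obtain G where G: "\<And>e. e \<in> E \<Longrightarrow> d e = n \<Longrightarrow> continuous_map (cell_cylinder (d e)) euclidean (G e)"
    "\<And>e x t. e \<in> E \<Longrightarrow> d e = n \<Longrightarrow> (x, t) \<in> cylinder_frame (d e) \<Longrightarrow> G e (x, t) = H (\<Phi> e x) t"
    by metis
  define H' where "H' y t = (if d (the_cell y) = n
    then G (the_cell y) (inv_into (cell_interior n) (\<Phi> (the_cell y)) y, t) else H y t)" for y t
  have H'_interior: "H' (\<Phi> e x) t = G e (x, t)" if "e \<in> E" "d e = n" "x \<in> cell_interior n" for e x t
  proof -
    have "the_cell (\<Phi> e x) = e" using the_cell_\<Phi>_interior that by simp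
    moreover have "inv_into (cell_interior n) (\<Phi> e) (\<Phi> e x) = x"
      using inj_interior[OF that(1)] that by (intro inv_into_f_f) auto
    ultimately show ?thesis using that(2) by (simp add: H'_def)
  qed
  have H'_G: "H' (\<Phi> e x) t = G e (x, t)"
    if e: "e \<in> E" "d e = n" and x: "x \<in> topspace (cell_disk n)" and t: "t \<in> {0..1}" for e x t
  proof (cases "x \<in> cell_interior n")
    case True
    then show ?thesis using H'_interior e by blast
  next
    case False
    then have b: "x \<in> cell_boundary (d e)" using x e by (auto simp: topspace_cell_disk)
    then have "H' (\<Phi> e x) t = H (\<Phi> e x) t"
      using the_cell_\<Phi>_boundary[OF e(1) b] e(2) by (simp add: H'_def)
    then show ?thesis using G(2)[OF e] b t by (auto simp: cylinder_frame_def)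
  qed
  have "continuous_on_cell H' e" if e: "e \<in> E" "d e < Suc n" for e
  proof (cases "d e = n")
    case True
    show ?thesis
      unfolding continuous_on_cell_def
      by (rule continuous_map_eq[OF G(1)[OF e(1) True]]) (use H'_G[OF e(1) True] True in auto)
  next
    case False
    then have "d e < n" using e(2) by simp
    then show ?thesis
      using the_cell_\<Phi>_le[OF e(1)]
      by (intro continuous_on_cell_cong[OF cells[OF e(1)]]) (force simp: H'_def)+
  qed
  moreover have "H' y c = H y c" if y: "y \<in> topspace X" and c: "c \<in> {0, 1}" for y c
  proof (cases "d (the_cell y) = n")
    case True
    obtain e x where ex: "e \<in> E" "x \<in> cell_interior (d e)" "y = \<Phi> e x"
      using y by (rule in_cellE)
    then have "d e = n" using True the_cell_\<Phi>_interior by simp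
    then show ?thesis
      using H'_interior[of e x c] G(2)[of e x c] ex c by (auto simp: cylinder_frame_def topspace_cell_disk)
  qed (simp add: H'_def)
  ultimately have "skeleton_homotopy w0 w1 (Suc n) H'"
    using ends by (simp add: skeleton_homotopy_def)
  then show ?thesis
    by (rule that) (auto simp: H'_def)
qed

text \<open>The value at a point no longer changes once the skeleton contains the cell of the point, so the
  homotopies on the skeleta have a common limit.\<close>

proposition maps_to_longray_homotopic:
  assumes w: "continuous_map X euclidean w0" "continuous_map X euclidean w1"
  obtains H :: "real \<Rightarrow> 'b \<Rightarrow> longray"
  where "\<And>t. t \<in> {0..1} \<Longrightarrow> continuous_map X euclidean (H t)"
    "\<And>y. y \<in> topspace X \<Longrightarrow> continuous_on {0..1} (\<lambda>t. H t y)"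
    "\<And>y. y \<in> topspace X \<Longrightarrow> H 0 y = w0 y" "\<And>y. y \<in> topspace X \<Longrightarrow> H 1 y = w1 y"
proof -
  have "\<exists>Hs. \<forall>n. skeleton_homotopy w0 w1 n (Hs n) \<and>
      (\<forall>y\<in>topspace X. d (the_cell y) < n \<longrightarrow> Hs (Suc n) y = Hs n y)"
  proof (rule dependent_nat_choice)
    \<comment> \<open>For \<open>n = 0\<close> no cell imposes continuity, so a jump at time \<open>0\<close> is admissible.\<close>
    show "\<exists>H. skeleton_homotopy w0 w1 0 H"
      by (rule exI[of _ "\<lambda>y t. if t = 0 then w0 y else w1 y"]) (simp add: skeleton_homotopy_def)
    show "\<exists>H'. skeleton_homotopy w0 w1 (Suc n) H' \<and>
        (\<forall>y\<in>topspace X. d (the_cell y) < n \<longrightarrow> H' y = H y)"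
      if "skeleton_homotopy w0 w1 n H" for H n
      by (rule skeleton_homotopy_extend[OF w that]) blast
  qed
  then obtain Hs where *: "\<forall>n. skeleton_homotopy w0 w1 n (Hs n) \<and>
      (\<forall>y\<in>topspace X. d (the_cell y) < n \<longrightarrow> Hs (Suc n) y = Hs n y)" ..
  have Hs_skeleton: "skeleton_homotopy w0 w1 n (Hs n)" for n
    by (rule conjunct1[OF *[THEN spec]])
  have Hs_Suc: "Hs (Suc n) y = Hs n y" if "y \<in> topspace X" "d (the_cell y) < n" for n y
    by (rule conjunct2[OF *[THEN spec], THEN bspec, THEN mp, OF that])
  have stable: "Hs n y = Hs (Suc (d (the_cell y))) y"
    if "y \<in> topspace X" "d (the_cell y) < n" for n y
    using that(2)
  proof (induction n)
    case (Suc n)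
    then show ?case using Hs_Suc[OF that(1), of n] by (cases "n = d (the_cell y)") auto
  qed simp
  define H where "H y = Hs (Suc (d (the_cell y))) y" for y
  have cell: "continuous_on_cell H e" if e: "e \<in> E" for e
  proof (rule continuous_on_cell_cong)
    show "continuous_on_cell (Hs (Suc (d e))) e"
      using Hs_skeleton[of "Suc (d e)"] e by (simp add: skeleton_homotopy_def)
    show "Hs (Suc (d e)) (\<Phi> e x) t = H (\<Phi> e x) t" if "x \<in> topspace (cell_disk (d e))" for x t
    proof -
      have "d (the_cell (\<Phi> e x)) < Suc (d e)" using the_cell_\<Phi>_le[OF e that] by simp
      then show ?thesis unfolding H_def by (rule stable[OF \<Phi>_in_topspace[OF e that], THEN fun_cong])
    qed
  qed
  show ?thesis
  proof
    fix t :: real assume t: "t \<in> {0..1}"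
    show "continuous_map X euclidean (\<lambda>y. H y t)"
    proof (rule continuous_mapI)
      fix e assume e: "e \<in> E"
      have "continuous_map (cell_disk (d e)) (cell_cylinder (d e)) (\<lambda>x. (x, t))"
        using t by (simp add: continuous_map_pairwise comp_def)
      from continuous_map_compose[OF this cell[OF e, unfolded continuous_on_cell_def]]
      show "continuous_map (cell_disk (d e)) euclidean ((\<lambda>y. H y t) \<circ> \<Phi> e)"
        by (simp add: comp_def)
    qed
  next
    fix y assume y: "y \<in> topspace X"
    then obtain e x where ex: "e \<in> E" "x \<in> cell_interior (d e)" "y = \<Phi> e x"
      by (rule in_cellE)
    have "continuous_map unit_interval (cell_cylinder (d e)) (\<lambda>t. (x, t))"
      using ex(2) by (simp add: continuous_map_pairwise comp_def topspace_cell_disk)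
    from continuous_map_compose[OF this cell[OF ex(1), unfolded continuous_on_cell_def]]
    show "continuous_on {0..1} (H y)"
      by (simp add: comp_def ex(3))
    show "H y 0 = w0 y" "H y 1 = w1 y"
      using Hs_skeleton y by (auto simp: H_def skeleton_homotopy_def)
  qed
qed

end

section \<open>Homotopy type of manifolds with a functionally narrow subspace\<close>

theorem theorem1p5:
  fixes M :: "'a topology" and U :: "omega1 \<Rightarrow> 'a set" and D :: "'a set"
  assumes "manifold M"
    and "\<not> metrizable_space M"
    and "type_I_cover M U" and "canonical_cover U"
    and "closedin M D" and "\<not> Lindelof_space (subtopology M D)"
    and "functionally_narrow M U D"
  shows "\<not> (\<exists>K :: 'b topology. CW_complex K \<and> M homotopy_equivalent_space K)"
proof
  assume "\<exists>K :: 'b topology. CW_complex K \<and> M homotopy_equivalent_space K"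
  then obtain K :: "'b topology" and E d \<Phi> f g where "CW_structure K E d \<Phi>"
    and f: "continuous_map M K f" and g: "continuous_map K M g"
    and gf: "homotopic_with (\<lambda>_. True) M M (g \<circ> f) id"
    unfolding CW_complex_def homotopy_equivalent_space_def by blast
  then interpret CW K E d \<Phi> by unfold_locales
  have reg: "regular_space M"
    using assms(1) manifold_imp_locally_compact_space locally_compact_Hausdorff_imp_regular_space
    by (auto simp: manifold_def)
  obtain s :: "'a \<Rightarrow> longray" where s: "continuous_map M euclidean s"
    "\<And>a. \<exists>b. \<forall>x \<in> topspace M - U b. longray_of a < s x"
    by (rule type_I_cover_unbounded_map[OF reg assms(3)]) blast
  have DM: "D \<subseteq> topspace M" by (rule closedin_subset[OF assms(5)])
  have D: "\<not> D \<subseteq> U a" for a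
    by (rule non_Lindelof_closed_imp_unbounded[OF assms(3,5,6)])
  have s_unbdd: "\<not> bdd_above (s ` D)"
    unfolding bdd_above_longray_iff using s(2) D DM by (metis DiffI imageI leD subsetD subsetI)
  obtain h where h: "continuous_map (prod_topology unit_interval M) M h"
    "\<And>x. h (0, x) = x" "\<And>x. h (1, x) = g (f x)"
    using homotopic_with_symD[OF gf] unfolding homotopic_with_def by auto
  have sh: "continuous_map (prod_topology unit_interval M) euclidean (s \<circ> h)"
    by (rule continuous_map_compose[OF h(1) s(1)])
  have "\<not> bdd_above ((\<lambda>x. s (h (1, x))) ` D)"
  proof (rule unbounded_on_narrow_homotopy_invariant[OF assms(7) D])
    show "continuous_map M euclidean (\<lambda>x. s (h (t, x)))" if "t \<in> {0..1}" for t
      using continuous_map_compose[OF _ sh, of M "\<lambda>x. (t, x)"] that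
      by (simp add: continuous_map_pairwise comp_def)
    show "continuous_on {0..1} (\<lambda>t. s (h (t, x)))" if "x \<in> D" for x
      using continuous_map_compose[OF _ sh, of unit_interval "\<lambda>t. (t, x)"] that DM
      by (auto simp: continuous_map_pairwise comp_def)
  qed (simp add: h s_unbdd)
  then have sgf_unbdd: "\<not> bdd_above ((\<lambda>x. s (g (f x))) ` D)"
    by (simp add: h)
  have sg: "continuous_map K euclidean (s \<circ> g)"
    by (rule continuous_map_compose[OF g s(1)])
  obtain H :: "real \<Rightarrow> 'b \<Rightarrow> longray" where H:
    "\<And>t. t \<in> {0..1} \<Longrightarrow> continuous_map K euclidean (H t)"
    "\<And>y. y \<in> topspace K \<Longrightarrow> continuous_on {0..1} (\<lambda>t. H t y)"
    "\<And>y. y \<in> topspace K \<Longrightarrow> H 0 y = (s \<circ> g) y" "\<And>y. y \<in> topspace K \<Longrightarrow> H 1 y = 0"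
    by (rule maps_to_longray_homotopic[OF sg, of "\<lambda>_. 0"]) auto
  have fD: "f x \<in> topspace K" if "x \<in> D" for x
    using continuous_map_image_subset_topspace[OF f] that DM by blast
  have "\<not> bdd_above ((\<lambda>x. H 1 (f x)) ` D)"
  proof (rule unbounded_on_narrow_homotopy_invariant[OF assms(7) D])
    show "continuous_map M euclidean (\<lambda>x. H t (f x))" if "t \<in> {0..1}" for t
      using continuous_map_compose[OF f H(1)[OF that]] by (simp add: comp_def)
    show "continuous_on {0..1} (\<lambda>t. H t (f x))" if "x \<in> D" for x
      by (rule H(2)[OF fD[OF that]])
    have "(\<lambda>x. H 0 (f x)) ` D = (\<lambda>x. s (g (f x))) ` D"
      using H(3)[OF fD] by (auto simp: image_iff)
    then show "\<not> bdd_above ((\<lambda>x. H 0 (f x)) ` D)" using sgf_unbdd by simp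
  qed
  moreover have "bdd_above ((\<lambda>x. H 1 (f x)) ` D)"
    using H(4)[OF fD] by (intro bdd_aboveI2[of _ _ 0]) simp
  ultimately show False by blast
qed

end
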